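(* Let $0<q<1$ and $0<s<1$, and let $$b(q,s)=\frac{\ln\frac{q^s-q}{(s-1)\ln q}}{\ln q}.$$ The inequality $$\frac{\Gamma_q(x+1)}{\Gamma_q(x+s)}<e^{(1-s)\psi_q(x+b(q,s))}$$ holds for all $x>0$, and the value $b(q,s)$ is best possible; that is, $b(q,s)$ is the smallest constant $c$ such that $\Gamma_q(x+1)/\Gamma_q(x+s)<e^{(1-s)\psi_q(x+c)}$ is defined and holds for all $x>0$.
   Context: For $0<q<1$ and $x>0$, the $q$-gamma function is $$\Gamma_q(x)=\frac{(q;q)_\infty}{(q^x;q)_\infty}(1-q)^{1-x},\qquad (a;q)_\infty=\prod_{n=0}^\infty(1-aq^n),$$ and $\psi_q=\Gamma_q'/\Gamma_q$ is its logarithmic derivative; both $\Gamma_q$ and $\psi_q$ are regarded as functions on $(0,+\infty)$ only. *)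

theory Defs
  imports "HOL-Analysis.Analysis"
begin

definition qpoch_inf :: "real \<Rightarrow> real \<Rightarrow> real" where
  "qpoch_inf a q = (\<Prod>n. 1 - a * q ^ n)"

text \<open>\<open>qGamma q\<close> and \<open>qpsi q\<close> are intended for \<open>0 < q < 1\<close> and positive arguments only.
  HOL functions being total, they have values elsewhere too, so statements must guard their
  arguments.\<close>

definition qGamma :: "real \<Rightarrow> real \<Rightarrow> real" where
  "qGamma q x = qpoch_inf q q / qpoch_inf (q powr x) q * (1 - q) powr (1 - x)"

definition qpsi :: "real \<Rightarrow> real \<Rightarrow> real" where
  "qpsi q x = deriv (qGamma q) x / qGamma q x"

definition b_const :: "real \<Rightarrow> real \<Rightarrow> real" where
  "b_const q s = ln ((q powr s - q) / ((s - 1) * ln q)) / ln q"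

text \<open>The conjunct \<open>x + c > 0\<close> says that \<open>qpsi q (x + c)\<close> is defined; the arguments
  \<open>x + 1\<close> and \<open>x + s\<close> are positive for \<open>s > 0\<close>.\<close>

definition qGamma_ratio_bound :: "real \<Rightarrow> real \<Rightarrow> real \<Rightarrow> bool" where
  "qGamma_ratio_bound q s c \<longleftrightarrow>
     (\<forall>x>0. x + c > 0 \<and>
        qGamma q (x + 1) / qGamma q (x + s) < exp ((1 - s) * qpsi q (x + c)))"

end

theory Submission
  imports Defs
begin

text \<open>
  Taking logarithms, the inequality at \<open>x\<close> with constant \<open>c\<close> says that a series
  \<open>\<Sum>n. ratio_gap q s c (q\<^sup>x q\<^sup>n)\<close> is positive. By definition \<open>q powr b_const q s\<close> is the
  mean of \<open>exp\<close> over the interval from \<open>ln q\<close> to \<open>s ln q\<close> (the logarithmic mean of \<open>q\<^sup>s\<close> and \<open>q\<close>),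
  so for \<open>c = b_const q s\<close> every term is positive by the strict Jensen inequality for the convex
  function \<open>t v / (1 - t v)\<close> of \<open>v\<close>. If \<open>c < b_const q s\<close>, the derivative of \<open>ratio_gap q s c\<close> at
  \<open>0\<close> is negative, so all terms are negative as soon as \<open>x\<close> is large.
\<close>

section \<open>The logarithm of the q-Pochhammer symbol and its derivative\<close>

definition qlog :: "real \<Rightarrow> real \<Rightarrow> real" where
  "qlog q a = (\<Sum>n. ln (1 - a * q ^ n))"

lemma mult_power_le_abs:
  fixes a q :: real
  assumes "0 < q" "q < 1"
  shows "a * q ^ n \<le> \<bar>a\<bar>"
proof -
  have "a * q ^ n \<le> \<bar>a\<bar> * q ^ n"
    using assms by (intro mult_right_mono) auto
  also have "\<dots> \<le> \<bar>a\<bar> * 1"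
    using assms by (intro mult_left_mono power_le_one) auto
  finally show ?thesis by simp
qed

text \<open>Termwise differentiation is legitimate on \<open>{-r..r}\<close> with
  \<open>\<bar>a\<bar> < r < 1\<close>: there the differentiated terms are dominated by the
  geometric series \<open>q ^ n / (1 - r)\<close>.\<close>

lemma
  fixes a q :: real
  assumes q: "0 < q" "q < 1" and a: "\<bar>a\<bar> < 1"
  shows summable_qlog: "summable (\<lambda>n. ln (1 - a * q ^ n))"
    and summable_qlog_deriv: "summable (\<lambda>n. - (q ^ n) / (1 - a * q ^ n))"
    and DERIV_qlog: "(qlog q has_real_derivative (\<Sum>n. - (q ^ n) / (1 - a * q ^ n))) (at a)"
proof -
  define r where "r = (1 + \<bar>a\<bar>) / 2"
  have r: "\<bar>a\<bar> < r" "0 < r" "r < 1"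
    using a by (auto simp: r_def)
  have low: "1 - r \<le> 1 - v * q ^ n" if "v \<in> {-r..r}" for v n
    using mult_power_le_abs[OF q, of v n] that by auto
  have bound: "norm (- (q ^ n) / (1 - v * q ^ n)) \<le> q ^ n / (1 - r)" if "v \<in> {-r..r}" for v n
    using low[OF that, of n] r q by (auto simp: abs_mult intro!: divide_left_mono)
  have sumM: "summable (\<lambda>n. q ^ n / (1 - r))"
    using q by (intro summable_divide summable_geometric) auto
  have unif: "uniformly_convergent_on {-r..r} (\<lambda>n v. \<Sum>i<n. - (q ^ i) / (1 - v * q ^ i))"
    using Weierstrass_m_test[OF bound sumM] by (rule uniformly_convergentI)
  have der: "((\<lambda>v. ln (1 - v * q ^ n)) has_real_derivative - (q ^ n) / (1 - v * q ^ n))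
      (at v within {-r..r})" if "v \<in> {-r..r}" for v n
    using low[OF that, of n] r
    by (auto intro!: derivative_eq_intros)
  have int: "a \<in> interior {-r..r}"
    using r by auto
  \<comment> \<open>Convergence of the series itself is required at one point only; at
    \<open>0\<close> every term is \<open>ln 1 = 0\<close>.\<close>
  note * = has_field_derivative_series'[OF convex_real_interval(5) der unif, of 0 a]
  show "summable (\<lambda>n. ln (1 - a * q ^ n))"
    using *(1) r int by simp
  show "(qlog q has_real_derivative (\<Sum>n. - (q ^ n) / (1 - a * q ^ n))) (at a)"
    unfolding qlog_def[abs_def] using *(2) r int by simp
  show "summable (\<lambda>n. - (q ^ n) / (1 - a * q ^ n))"
    using r by (intro summable_comparison_test'[OF sumM] bound) auto
qed

lemma qpoch_inf_eq_exp:
  assumes q: "0 < q" "q < 1" and a: "\<bar>a\<bar> < 1"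
  shows "qpoch_inf a q = exp (qlog q a)"
proof -
  have "exp (ln (1 - a * q ^ n)) = 1 - a * q ^ n" for n
    using mult_power_le_abs[OF q, of a n] a by simp
  then show ?thesis
    using prodinf_exp[OF summable_qlog[OF assms]] by (simp add: qpoch_inf_def qlog_def)
qed

section \<open>Series for the q-gamma function and its logarithmic derivative\<close>

lemma qGamma_eq_exp:
  assumes q: "0 < q" "q < 1" and y: "0 < y"
  shows "qGamma q y = exp (qlog q q - qlog q (q powr y) + (1 - y) * ln (1 - q))"
proof -
  have "q powr y < 1"
    using q y by (simp add: powr01_less_one)
  with q show ?thesis
    by (simp add: qGamma_def qpoch_inf_eq_exp exp_add exp_diff powr_def)
qed

lemma qpsi_eq:
  assumes q: "0 < q" "q < 1" and y: "0 < y"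
  shows "qpsi q y = - ln (1 - q)
    - (q powr y * ln q) * (\<Sum>n. - (q ^ n) / (1 - q powr y * q ^ n))"
proof -
  define L where "L = (\<Sum>n. - (q ^ n) / (1 - q powr y * q ^ n))"
  define E where "E z = exp (qlog q q - qlog q (q powr z) + (1 - z) * ln (1 - q))" for z
  have lt: "\<bar>q powr y\<bar> < 1"
    using q y by (simp add: powr01_less_one)
  have pw: "((\<lambda>z. q powr z) has_real_derivative q powr y * ln q) (at y)"
    using q by (auto intro!: derivative_eq_intros)
  have ql: "((\<lambda>z. qlog q (q powr z)) has_real_derivative L * (q powr y * ln q)) (at y)"
    using DERIV_chain2[OF DERIV_qlog[OF q lt] pw] by (simp add: L_def)
  have "(E has_real_derivative E y * (- ln (1 - q) - (q powr y * ln q) * L)) (at y)"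
    unfolding E_def by (rule derivative_eq_intros ql refl)+ (simp add: algebra_simps)
  \<comment> \<open>The exponential formula for \<open>qGamma\<close> is available for positive
    arguments only, so the derivative is transferred along this open half-line.\<close>
  moreover have "open {0::real<..}" "y \<in> {0<..}"
    using y by auto
  moreover have "E z = qGamma q z" if "z \<in> {0<..}" for z
    using qGamma_eq_exp[OF q, of z] that by (simp add: E_def)
  ultimately have "(qGamma q has_real_derivative
      E y * (- ln (1 - q) - (q powr y * ln q) * L)) (at y)"
    by (rule has_field_derivative_transform_within_open)
  moreover have "qGamma q y = E y" "E y \<noteq> 0"
    using qGamma_eq_exp[OF q y] by (simp_all add: E_def)
  ultimately show ?thesis
    by (simp add: qpsi_def DERIV_imp_deriv L_def)
qed

text \<open>One term of the logarithm of the right side minus that of the left side. The variable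
  \<open>x\<close> enters only through \<open>t\<close>, which stands for
  \<open>q powr (x + n)\<close>.\<close>

definition ratio_gap :: "real \<Rightarrow> real \<Rightarrow> real \<Rightarrow> real \<Rightarrow> real" where
  "ratio_gap q s c t = ln (1 - q * t) - ln (1 - q powr s * t)
     + (1 - s) * ln q * (q powr c * t / (1 - q powr c * t))"

text \<open>After taking logarithms, both sides contain \<open>(s - 1) * ln (1 - q)\<close>, which
  cancels; the three remaining series combine term by term.\<close>

lemma
  assumes q: "0 < q" "q < 1" and s: "0 < s" and x: "0 < x" "0 < x + c"
  shows summable_ratio_gap: "summable (\<lambda>n. ratio_gap q s c (q powr x * q ^ n))"
    and qGamma_ratio_less_iff:
      "qGamma q (x + 1) / qGamma q (x + s) < exp ((1 - s) * qpsi q (x + c)) \<longleftrightarrow>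
       0 < (\<Sum>n. ratio_gap q s c (q powr x * q ^ n))"
proof -
  let ?f = "\<lambda>n. - (q ^ n) / (1 - q powr (x + c) * q ^ n)"
  let ?k = "(1 - s) * ln q * q powr (x + c)"
  have small: "\<bar>q powr y\<bar> < 1" if "0 < y" for y
    using q that by (simp add: powr01_less_one)
  have gap: "ratio_gap q s c (q powr x * q ^ n) =
      ln (1 - q powr (x + 1) * q ^ n) - ln (1 - q powr (x + s) * q ^ n) - ?k * ?f n" for n
    using q by (simp add: ratio_gap_def powr_add mult_ac)
  have S1: "summable (\<lambda>n. ln (1 - q powr (x + 1) * q ^ n))"
    and S2: "summable (\<lambda>n. ln (1 - q powr (x + s) * q ^ n))"
    and S3: "summable ?f"
    using x s by (intro summable_qlog summable_qlog_deriv q small; simp)+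
  have S4: "summable (\<lambda>n. ?k * ?f n)"
    using S3 by (rule summable_mult)
  show "summable (\<lambda>n. ratio_gap q s c (q powr x * q ^ n))"
    unfolding gap by (intro summable_diff S1 S2 S4)
  have "(\<Sum>n. ratio_gap q s c (q powr x * q ^ n)) =
      qlog q (q powr (x + 1)) - qlog q (q powr (x + s)) - ?k * (\<Sum>n. ?f n)"
    unfolding gap qlog_def
    by (simp only: suminf_diff[OF summable_diff[OF S1 S2] S4, symmetric]
        suminf_diff[OF S1 S2, symmetric] suminf_mult[OF S3, symmetric])
  moreover have "qGamma q (x + 1) / qGamma q (x + s) =
      exp (qlog q (q powr (x + s)) - qlog q (q powr (x + 1)) + (s - 1) * ln (1 - q))"
    using x s q by (simp add: qGamma_eq_exp exp_diff[symmetric] algebra_simps)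
  moreover have "(1 - s) * qpsi q (x + c) = (s - 1) * ln (1 - q) - ?k * (\<Sum>n. ?f n)"
    unfolding qpsi_eq[OF q x(2)] by (simp add: algebra_simps)
  ultimately show "qGamma q (x + 1) / qGamma q (x + s) < exp ((1 - s) * qpsi q (x + c)) \<longleftrightarrow>
       0 < (\<Sum>n. ratio_gap q s c (q powr x * q ^ n))"
    by auto
qed

text \<open>The right side is the integral of \<open>t * exp u / (1 - t * exp u)\<close> over
  \<open>u\<close> from \<open>A\<close> to \<open>B\<close>, and \<open>mean\<close> says that
  \<open>exp m\<close> is the average of \<open>exp u\<close> there. Jensen's inequality is obtained
  without integrals, from the growth of an antiderivative.\<close>

lemma Jensen_exp_mean_less:
  fixes A B m t :: real
  assumes m: "A < m" "m < B" and mean: "(B - A) * exp m = exp B - exp A"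
    and t: "0 < t" "t * exp B < 1"
  shows "(B - A) * (t * exp m / (1 - t * exp m)) < ln (1 - t * exp A) - ln (1 - t * exp B)"
proof -
  \<comment> \<open>\<open>G\<close> and \<open>G'\<close> are the value and the slope of
    \<open>t v / (1 - t v)\<close> at \<open>v = exp m\<close>.\<close>
  define G where "G = t * exp m / (1 - t * exp m)"
  define G' where "G' = t / (1 - t * exp m)\<^sup>2"
  \<comment> \<open>Its derivative is the gap between \<open>t v / (1 - t v)\<close> at \<open>v = exp u\<close> and the tangent at \<open>exp m\<close>.\<close>
  define F where "F u = - ln (1 - t * exp u) - G * u - G' * (exp u - exp m * u)" for u
  have below: "t * exp u < 1" if "u \<le> B" for u
    using t that by (smt (verit) mult_left_mono exp_le_cancel_iff)
  have der: "(F has_real_derivative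
      t\<^sup>2 * (exp u - exp m)\<^sup>2 / ((1 - t * exp u) * (1 - t * exp m)\<^sup>2)) (at u)" if "u \<le> B" for u
  proof -
    have pos: "0 < 1 - t * exp u" "0 < 1 - t * exp m"
      using below[OF that] below[of m] m by auto
    have tangent: "t * v / (1 - t * v) - t * w / (1 - t * w) - t / (1 - t * w)\<^sup>2 * (v - w) =
        t\<^sup>2 * (v - w)\<^sup>2 / ((1 - t * v) * (1 - t * w)\<^sup>2)"
      if "0 < 1 - t * v" "0 < 1 - t * w" for v w
    proof -
      have "1 - t * v \<noteq> 0" "1 - t * w \<noteq> 0"
        using that by auto
      then show ?thesis
        by (simp add: divide_simps power2_eq_square) (simp add: algebra_simps)
    qed
    have "(F has_real_derivative t * exp u / (1 - t * exp u) - G - G' * (exp u - exp m)) (at u)"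
      unfolding F_def using pos by (auto intro!: derivative_eq_intros)
    then show ?thesis
      using tangent[OF pos] by (simp add: G_def G'_def)
  qed
  have cont: "continuous_on {C..D} F" if "D \<le> B" for C D
    using der that by (intro DERIV_atLeastAtMost_imp_continuous_on) (meson order_trans)
  have incr: "\<exists>y. (F has_real_derivative y) (at u) \<and> 0 < y" if "u \<le> B" "u \<noteq> m" for u
    using der[OF that(1)] below[OF that(1)] below[of m] m t that(2)
    by (intro exI[of _ "t\<^sup>2 * (exp u - exp m)\<^sup>2 / ((1 - t * exp u) * (1 - t * exp m)\<^sup>2)"])
      (auto intro!: divide_pos_pos mult_pos_pos)
  \<comment> \<open>The derivative of \<open>F\<close> vanishes at \<open>m\<close>, so strict
    growth is shown on each side of \<open>m\<close> separately.\<close>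
  have "F A < F m"
    by (rule DERIV_pos_imp_increasing_open[OF m(1)]; (rule cont incr)?; use m in simp)
  also have "F m < F B"
    by (rule DERIV_pos_imp_increasing_open[OF m(2)]; (rule cont incr)?; simp)
  finally have "F A < F B" .
  \<comment> \<open>The factor of \<open>G'\<close> is zero by \<open>mean\<close>: the linear part
    of the tangent averages out.\<close>
  moreover have "F B - F A = ln (1 - t * exp A) - ln (1 - t * exp B) - (B - A) * G
      - G' * (exp B - exp A - (B - A) * exp m)"
    by (simp add: F_def algebra_simps)
  ultimately show ?thesis
    using mean by (simp add: G_def)
qed

text \<open>The mean value theorem for \<open>exp\<close> between \<open>ln q\<close> and
  \<open>s * ln q\<close> yields a point \<open>m\<close>, and \<open>b_const q s\<close> is
  \<open>m / ln q\<close>; dividing by the negative \<open>ln q\<close> reverses the bounds on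
  \<open>m\<close>.\<close>

lemma
  assumes q: "0 < q" "q < 1" and s: "0 < s" "s < 1"
  shows less_b_const: "s < b_const q s"
    and b_const_less_1: "b_const q s < 1"
    and powr_b_const: "(s - 1) * ln q * q powr b_const q s = q powr s - q"
proof -
  have lnq: "ln q < 0"
    using q by simp
  have lt: "ln q < s * ln q"
    using lnq s by simp
  obtain m where m: "ln q < m" "m < s * ln q"
    and mean: "exp (s * ln q) - exp (ln q) = (s * ln q - ln q) * exp m"
    using MVT2[OF lt, of exp exp] by auto
  have mean': "q powr s - q = (s - 1) * ln q * exp m"
    using mean q by (simp add: powr_def algebra_simps)
  have "(s - 1) * ln q \<noteq> 0"
    using lnq s by simp
  then have "(q powr s - q) / ((s - 1) * ln q) = exp m"
    using mean' by simp
  then have b: "b_const q s = m / ln q"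
    by (simp add: b_const_def)
  show "s < b_const q s" "b_const q s < 1"
    using m lnq by (simp_all add: b field_simps)
  show "(s - 1) * ln q * q powr b_const q s = q powr s - q"
    using mean' lnq q by (simp add: b powr_def)
qed

lemma ratio_gap_b_const_pos:
  assumes q: "0 < q" "q < 1" and s: "0 < s" "s < 1" and t: "0 < t" "t < 1"
  shows "0 < ratio_gap q s (b_const q s) t"
proof -
  let ?b = "b_const q s"
  have lnq: "ln q < 0"
    using q by simp
  have exps: "exp (ln q) = q" "exp (s * ln q) = q powr s" "exp (?b * ln q) = q powr ?b"
    using q by (simp_all add: powr_def)
  have "q powr s < 1"
    using q s by (simp add: powr01_less_one)
  then have "t * q powr s < 1"
    using t q by (smt (verit) mult_less_cancel_left2 powr_gt_zero)
  \<comment> \<open>Jensen with \<open>A = ln q\<close>, \<open>B = s * ln q\<close> and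
    \<open>m = ?b * ln q\<close>; the mean condition is \<open>powr_b_const\<close>.\<close>
  then have "(s * ln q - ln q) * (t * exp (?b * ln q) / (1 - t * exp (?b * ln q)))
      < ln (1 - t * exp (ln q)) - ln (1 - t * exp (s * ln q))"
    using less_b_const[OF q s] b_const_less_1[OF q s] powr_b_const[OF q s] lnq t
    by (intro Jensen_exp_mean_less; simp add: exps; simp add: algebra_simps)
  then show ?thesis
    unfolding exps by (simp add: ratio_gap_def algebra_simps diff_divide_distrib)
qed

lemma ratio_gap_neg_near_0:
  assumes q: "0 < q" "q < 1" and s: "0 < s" "s < 1" and c: "c < b_const q s"
  shows "\<exists>d>0. \<forall>t. 0 < t \<longrightarrow> t < d \<longrightarrow> ratio_gap q s c t < 0"
proof -
  \<comment> \<open>Minus the slope of \<open>ratio_gap q s c\<close> at \<open>0\<close>. It would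
    be zero at \<open>c = b_const q s\<close>, and it grows as \<open>c\<close> decreases.\<close>
  define l where "l = q - q powr s - (1 - s) * ln q * q powr c"
  have "((\<lambda>t. - ratio_gap q s c t) has_real_derivative l) (at 0)"
    unfolding ratio_gap_def by (auto intro!: derivative_eq_intros simp: l_def)
  moreover have "0 < l"
  proof -
    have "q powr b_const q s < q powr c"
      using q c by (simp add: powr_less_mono')
    moreover have "0 < (s - 1) * ln q"
      using q s by (simp add: mult_neg_neg)
    ultimately have "(s - 1) * ln q * q powr b_const q s < (s - 1) * ln q * q powr c"
      by (rule mult_strict_left_mono)
    then show ?thesis
      using powr_b_const[OF q s] by (simp add: l_def algebra_simps)
  qed
  ultimately obtain d where "0 < d"
    "\<forall>h>0. h < d \<longrightarrow> - ratio_gap q s c 0 < - ratio_gap q s c (0 + h)"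
    using DERIV_pos_inc_right by blast
  then show ?thesis
    by (intro exI[of _ d]) (auto simp: ratio_gap_def)
qed

lemma powr_mult_power_le:
  fixes q x :: real
  assumes "0 < q" "q < 1"
  shows "q powr x * q ^ n \<le> q powr x"
  using mult_power_le_abs[OF assms, of "q powr x" n] by simp

theorem corollary3p2:
  fixes q s :: real
  assumes "0 < q" and "q < 1" and "0 < s" and "s < 1"
  shows "qGamma_ratio_bound q s (b_const q s) \<and>
         (\<forall>c. qGamma_ratio_bound q s c \<longrightarrow> b_const q s \<le> c)"
proof (intro conjI allI impI)
  show "qGamma_ratio_bound q s (b_const q s)"
    unfolding qGamma_ratio_bound_def
  proof (intro allI impI conjI)
    fix x :: real assume x: "0 < x"
    show xb: "0 < x + b_const q s"
      using x less_b_const[OF assms] assms(3) by simp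
    have "q powr x < 1"
      using assms x by (simp add: powr01_less_one)
    then have "0 < ratio_gap q s (b_const q s) (q powr x * q ^ n)" for n
      using assms by (intro ratio_gap_b_const_pos le_less_trans[OF powr_mult_power_le]) auto
    then show "qGamma q (x + 1) / qGamma q (x + s) < exp ((1 - s) * qpsi q (x + b_const q s))"
      using suminf_pos[OF summable_ratio_gap[OF assms(1-3) x xb]]
        qGamma_ratio_less_iff[OF assms(1-3) x xb] by blast
  qed
next
  fix c assume bound: "qGamma_ratio_bound q s c"
  show "b_const q s \<le> c"
  proof (rule ccontr)
    assume "\<not> b_const q s \<le> c"
    then have "c < b_const q s"
      by simp
    then obtain d where d: "0 < d" "\<And>t. 0 < t \<Longrightarrow> t < d \<Longrightarrow> ratio_gap q s c t < 0"
      using ratio_gap_neg_near_0[OF assms] by blast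
    \<comment> \<open>Chosen so that \<open>q powr x < d\<close>: as \<open>ln q < 0\<close>, this
      means \<open>x > ln d / ln q\<close>. The \<open>max\<close> keeps \<open>x\<close>
      positive.\<close>
    define x where "x = max 1 (ln d / ln q + 1)"
    have x: "0 < x"
      by (simp add: x_def)
    have "ln q < 0" "ln d / ln q < x"
      using assms by (simp_all add: x_def)
    then have "x * ln q < ln d"
      by (simp add: neg_divide_less_eq)
    then have "q powr x < d"
      using d(1) assms by (metis exp_less_mono exp_ln less_irrefl powr_def)
    then have neg: "ratio_gap q s c (q powr x * q ^ n) < 0" for n
      using assms by (intro d(2) le_less_trans[OF powr_mult_power_le]) auto
    \<comment> \<open>The assumed bound itself guarantees that \<open>qpsi\<close> is evaluated at a
      positive argument, which the series criterion needs.\<close>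
    have xc: "0 < x + c"
      and less: "qGamma q (x + 1) / qGamma q (x + s) < exp ((1 - s) * qpsi q (x + c))"
      using bound x by (auto simp: qGamma_ratio_bound_def)
    note sum = summable_ratio_gap[OF assms(1-3) x xc]
    have "0 < (\<Sum>n. ratio_gap q s c (q powr x * q ^ n))"
      using less qGamma_ratio_less_iff[OF assms(1-3) x xc] by blast
    moreover have "(\<Sum>n. ratio_gap q s c (q powr x * q ^ n)) \<le> (\<Sum>n. 0)"
      by (rule suminf_le[OF less_imp_le[OF neg] sum summable_zero])
    ultimately show False
      by simp
  qed
qed

end
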